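(* Every framed surface $(\boldsymbol{x},\boldsymbol{n},\boldsymbol{s}):U\to\mathbb{R}^3\times\Delta$ is an $(\boldsymbol{n},\overline{\boldsymbol{n}})$-Bertrand framed surface.
   Context: All maps are $C^\infty$. $U\subset\mathbb{R}^2$ is a simply connected domain with coordinates $(u,v)$, $S^2$ is the unit sphere in $\mathbb{R}^3$, and $\Delta=\{(\boldsymbol{a},\boldsymbol{b})\in S^2\times S^2 : \boldsymbol{a}\cdot\boldsymbol{b}=0\}$. A framed surface is a smooth map $(\boldsymbol{x},\boldsymbol{n},\boldsymbol{s}):U\to\mathbb{R}^3\times\Delta$ with $\boldsymbol{x}_u\cdot\boldsymbol{n}=\boldsymbol{x}_v\cdot\boldsymbol{n}=0$ on $U$. Put $\boldsymbol{t}=\boldsymbol{n}\times\boldsymbol{s}$. For a smooth $\lambda:U\to\mathbb{R}$, $\lambda\not\equiv0$ means that $\{(u,v)\in U:\lambda(u,v)\neq0\}$ is dense in $U$. Two framed surfaces $(\boldsymbol{x},\boldsymbol{n},\boldsymbol{s}),(\overline{\boldsymbol{x}},\overline{\boldsymbol{n}},\overline{\boldsymbol{s}}):U\to\mathbb{R}^3\times\Delta$ (with $\overline{\boldsymbol{t}}=\overline{\boldsymbol{n}}\times\overline{\boldsymbol{s}}$) are $(\boldsymbol{v},\overline{\boldsymbol{w}})$-mates, where each of $\boldsymbol{v},\boldsymbol{w}$ is one of $\boldsymbol{n},\boldsymbol{s},\boldsymbol{t}$, if there is a smooth $\lambda:U\to\mathbb{R}$ with $\lambda\not\equiv0$ such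 that $\overline{\boldsymbol{x}}=\boldsymbol{x}+\lambda\boldsymbol{v}$ and $\boldsymbol{v}=\overline{\boldsymbol{w}}$ on $U$. $(\boldsymbol{x},\boldsymbol{n},\boldsymbol{s})$ is a $(\boldsymbol{v},\overline{\boldsymbol{w}})$-Bertrand framed surface if there is a framed surface $(\overline{\boldsymbol{x}},\overline{\boldsymbol{n}},\overline{\boldsymbol{s}}):U\to\mathbb{R}^3\times\Delta$ such that the two are $(\boldsymbol{v},\overline{\boldsymbol{w}})$-mates. *)

theory Defs
  imports "HOL-Analysis.Analysis"
begin

text \<open>Derivatives are taken in the full space (\<open>at p\<close>), so these two notions are meant for open \<open>S\<close>.
  There \<open>smooth_on\<close> is the usual C-infinity class: all iterated directional derivatives exist and are
  Frechet differentiable on \<open>S\<close>. It does not depend on the values of \<open>f\<close> outside \<open>S\<close>.\<close>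

primrec times_differentiable_on ::
  "nat \<Rightarrow> ('a::real_normed_vector \<Rightarrow> 'b::real_normed_vector) \<Rightarrow> 'a set \<Rightarrow> bool" where
  "times_differentiable_on 0 f S \<longleftrightarrow> continuous_on S f"
| "times_differentiable_on (Suc k) f S \<longleftrightarrow>
     (\<forall>p\<in>S. f differentiable (at p)) \<and>
     (\<forall>h. times_differentiable_on k (\<lambda>p. frechet_derivative f (at p) h) S)"

definition smooth_on ::
  "('a::real_normed_vector \<Rightarrow> 'b::real_normed_vector) \<Rightarrow> 'a set \<Rightarrow> bool" where
  "smooth_on f S \<longleftrightarrow> (\<forall>k. times_differentiable_on k f S)"

definition partial_u :: "(real^2 \<Rightarrow> 'b::real_normed_vector) \<Rightarrow> real^2 \<Rightarrow> 'b" where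
  "partial_u f p = frechet_derivative f (at p) (axis 1 1)"

definition partial_v :: "(real^2 \<Rightarrow> 'b::real_normed_vector) \<Rightarrow> real^2 \<Rightarrow> 'b" where
  "partial_v f p = frechet_derivative f (at p) (axis 2 1)"

definition orthonormal_pairs :: "((real^3) \<times> (real^3)) set" where
  "orthonormal_pairs = {(a, b). a \<in> sphere 0 1 \<and> b \<in> sphere 0 1 \<and> a \<bullet> b = 0}"

text \<open>A map from \<open>U\<close> is represented by a total function of which only the values on \<open>U\<close> matter.
  Smoothness into the submanifold \<open>UNIV \<times> orthonormal_pairs\<close> is smoothness into the ambient space.\<close>

definition framed_surface ::
  "(real^2) set \<Rightarrow> (real^2 \<Rightarrow> real^3) \<Rightarrow> (real^2 \<Rightarrow> real^3) \<Rightarrow> (real^2 \<Rightarrow> real^3) \<Rightarrow> bool" where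
  "framed_surface U x n s \<longleftrightarrow>
     smooth_on (\<lambda>p. (x p, n p, s p)) U \<and>
     (\<forall>p\<in>U. (n p, s p) \<in> orthonormal_pairs) \<and>
     (\<forall>p\<in>U. partial_u x p \<bullet> n p = 0 \<and> partial_v x p \<bullet> n p = 0)"

datatype frame_vector = Frame_n | Frame_s | Frame_t

primrec frame_field ::
  "frame_vector \<Rightarrow> (real^2 \<Rightarrow> real^3) \<Rightarrow> (real^2 \<Rightarrow> real^3) \<Rightarrow> real^2 \<Rightarrow> real^3" where
  "frame_field Frame_n n s = n"
| "frame_field Frame_s n s = s"
| "frame_field Frame_t n s = (\<lambda>p. cross3 (n p) (s p))"

text \<open>The reading of ``not identically zero'' used for framed surfaces: the non-zero set is dense in \<open>U\<close>,
  which is stronger than having one non-zero value.\<close>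

definition nonzero_densely_on :: "(real^2 \<Rightarrow> real) \<Rightarrow> (real^2) set \<Rightarrow> bool" where
  "nonzero_densely_on l U \<longleftrightarrow> U \<subseteq> closure {p \<in> U. l p \<noteq> 0}"

definition mates ::
  "(real^2) set \<Rightarrow> frame_vector \<Rightarrow> frame_vector \<Rightarrow>
   (real^2 \<Rightarrow> real^3) \<Rightarrow> (real^2 \<Rightarrow> real^3) \<Rightarrow> (real^2 \<Rightarrow> real^3) \<Rightarrow>
   (real^2 \<Rightarrow> real^3) \<Rightarrow> (real^2 \<Rightarrow> real^3) \<Rightarrow> (real^2 \<Rightarrow> real^3) \<Rightarrow> bool" where
  "mates U v w x n s x' n' s' \<longleftrightarrow>
     framed_surface U x n s \<and> framed_surface U x' n' s' \<and>
     (\<exists>l. smooth_on l U \<and> nonzero_densely_on l U \<and>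
        (\<forall>p\<in>U. x' p = x p + l p *\<^sub>R frame_field v n s p \<and>
               frame_field v n s p = frame_field w n' s' p))"

definition Bertrand_framed_surface ::
  "(real^2) set \<Rightarrow> frame_vector \<Rightarrow> frame_vector \<Rightarrow>
   (real^2 \<Rightarrow> real^3) \<Rightarrow> (real^2 \<Rightarrow> real^3) \<Rightarrow> (real^2 \<Rightarrow> real^3) \<Rightarrow> bool" where
  "Bertrand_framed_surface U v w x n s \<longleftrightarrow>
     (\<exists>x' n' s'. framed_surface U x' n' s' \<and> mates U v w x n s x' n' s')"

end

theory Submission
  imports Defs
begin

text \<open>A parallel surface is a mate: with \<open>\<lambda> = 1\<close> put \<open>x' = x + n\<close>, \<open>n' = n\<close> and \<open>s' = s\<close>. Since \<open>n\<close> has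
  constant length, differentiating \<open>n \<bullet> n = 1\<close> shows that its partial derivatives are orthogonal to
  \<open>n\<close> (\<open>unit_field_derivative_orthogonal\<close>), so \<open>n\<close> is normal to \<open>x + n\<close> wherever it is normal to \<open>x\<close>.
  The new triple is the image of the old one under the linear map
  \<open>(a, b, c) \<mapsto> (a + b, b, c)\<close>, so it is smooth because postcomposition with a bounded linear map
  preserves smoothness (\<open>smooth_on_bounded_linear_comp\<close>).\<close>

text \<open>Differentiation commutes with a linear map only where the inner function is differentiable, so
  the inductions on the order of differentiability produce derivatives that agree merely on \<open>S\<close>.
  Openness makes such agreement enough, since a derivative at \<open>p \<in> S\<close> is then determined by the values
  on \<open>S\<close>.\<close>

lemma frechet_derivative_cong_on_open:
  assumes "open S" "p \<in> S" "\<And>q. q \<in> S \<Longrightarrow> f q = g q"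
  shows "frechet_derivative f (at p) = frechet_derivative g (at p)"
proof -
  have "(f has_derivative D) (at p) \<longleftrightarrow> (g has_derivative D) (at p)" for D
  proof
    assume "(f has_derivative D) (at p)"
    then show "(g has_derivative D) (at p)"
      using assms by (rule has_derivative_transform_within_open)
  next
    assume "(g has_derivative D) (at p)"
    then show "(f has_derivative D) (at p)"
      using assms(1,2) assms(3)[symmetric] by (rule has_derivative_transform_within_open)
  qed
  then show ?thesis
    unfolding frechet_derivative_def by simp
qed

lemma times_differentiable_on_cong:
  assumes "open S" "\<And>p. p \<in> S \<Longrightarrow> f p = g p" "times_differentiable_on k f S"
  shows "times_differentiable_on k g S"
  using assms(2,3)
proof (induction k arbitrary: f g)
  case 0
  have "continuous_on S f \<longleftrightarrow> continuous_on S g"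
    using refl 0(1) by (rule continuous_on_cong)
  with 0(2) show ?case
    by (simp only: times_differentiable_on.simps)
next
  case (Suc k)
  have "g differentiable (at p)" if "p \<in> S" for p
  proof -
    have "f differentiable (at p)"
      using Suc.prems(2) that by (simp only: times_differentiable_on.simps)
    then have "(f has_derivative frechet_derivative f (at p)) (at p)"
      by (simp only: frechet_derivative_works)
    then have "(g has_derivative frechet_derivative f (at p)) (at p)"
      using \<open>open S\<close> that Suc.prems(1) by (rule has_derivative_transform_within_open)
    then show ?thesis
      by (rule differentiableI)
  qed
  moreover have "times_differentiable_on k (\<lambda>p. frechet_derivative g (at p) h) S" for h
  proof (rule Suc.IH)
    show "frechet_derivative f (at p) h = frechet_derivative g (at p) h" if "p \<in> S" for p
    proof -
      have "frechet_derivative f (at p) = frechet_derivative g (at p)"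
        using \<open>open S\<close> that Suc.prems(1) by (rule frechet_derivative_cong_on_open)
      then show ?thesis
        by (rule fun_cong)
    qed
    show "times_differentiable_on k (\<lambda>p. frechet_derivative f (at p) h) S"
      using Suc.prems(2) unfolding times_differentiable_on.simps by blast
  qed
  ultimately show ?case
    by simp
qed

lemma frechet_derivative_bounded_linear_comp:
  assumes "bounded_linear L" "f differentiable (at p)"
  shows "frechet_derivative (\<lambda>q. L (f q)) (at p) = (\<lambda>h. L (frechet_derivative f (at p) h))"
  by (rule frechet_derivative_at[OF bounded_linear.has_derivative[OF assms(1)
          assms(2)[unfolded frechet_derivative_works]], symmetric])

lemma times_differentiable_on_bounded_linear_comp:
  assumes "open S" "bounded_linear L" "times_differentiable_on k f S"
  shows "times_differentiable_on k (\<lambda>p. L (f p)) S"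
  using assms(3)
proof (induction k arbitrary: f)
  case 0
  then have "continuous_on S f"
    by simp
  then have "continuous_on S (\<lambda>p. L (f p))"
    by (rule bounded_linear.continuous_on[OF assms(2)])
  then show ?case
    by simp
next
  case (Suc k)
  have diff: "f differentiable (at p)" if "p \<in> S" for p
    using Suc.prems that unfolding times_differentiable_on.simps by blast
  have "(\<lambda>p. L (f p)) differentiable (at p)" if "p \<in> S" for p
    by (rule differentiableI[OF bounded_linear.has_derivative[OF assms(2)
            diff[OF that, unfolded frechet_derivative_works]]])
  moreover have "times_differentiable_on k (\<lambda>p. frechet_derivative (\<lambda>p. L (f p)) (at p) h) S" for h
  proof (rule times_differentiable_on_cong[OF \<open>open S\<close>])
    show "times_differentiable_on k (\<lambda>p. L (frechet_derivative f (at p) h)) S"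
      using Suc.IH Suc.prems unfolding times_differentiable_on.simps by blast
    show "L (frechet_derivative f (at p) h) = frechet_derivative (\<lambda>p. L (f p)) (at p) h"
      if "p \<in> S" for p
      by (rule fun_cong[OF frechet_derivative_bounded_linear_comp[OF assms(2) diff[OF that]],
            symmetric])
  qed
  ultimately show ?case
    by simp
qed

lemma smooth_on_bounded_linear_comp:
  assumes "open S" "bounded_linear L" "smooth_on f S"
  shows "smooth_on (\<lambda>p. L (f p)) S"
  unfolding smooth_on_def
proof
  fix k
  have "times_differentiable_on k f S"
    using assms(3) unfolding smooth_on_def by blast
  then show "times_differentiable_on k (\<lambda>p. L (f p)) S"
    by (rule times_differentiable_on_bounded_linear_comp[OF assms(1,2)])
qed

lemma smooth_on_imp_differentiable:
  assumes "smooth_on f S" "p \<in> S"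
  shows "f differentiable (at p)"
proof -
  have "times_differentiable_on (Suc 0) f S"
    using assms(1) unfolding smooth_on_def by blast
  then show ?thesis
    using assms(2) by simp
qed

lemma smooth_on_const: "smooth_on (\<lambda>p. c) S"
proof -
  have "times_differentiable_on k (\<lambda>p. c) S" for k
    by (induction k arbitrary: c) simp_all
  then show ?thesis
    unfolding smooth_on_def by blast
qed

text \<open>Differentiate the constant function \<open>f \<bullet> f\<close>.\<close>

lemma unit_field_derivative_orthogonal:
  fixes f :: "'a::real_normed_vector \<Rightarrow> 'b::real_inner"
  assumes "open S" "p \<in> S" "f differentiable (at p)" "\<And>q. q \<in> S \<Longrightarrow> norm (f q) = 1"
  shows "frechet_derivative f (at p) h \<bullet> f p = 0"
proof -
  let ?D = "frechet_derivative f (at p)"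
  have "(f has_derivative ?D) (at p)"
    using assms(3) by (simp add: frechet_derivative_works)
  then have "((\<lambda>q. f q \<bullet> f q) has_derivative (\<lambda>h. f p \<bullet> ?D h + ?D h \<bullet> f p)) (at p)"
    by (intro has_derivative_inner)
  moreover have "((\<lambda>q. f q \<bullet> f q) has_derivative (\<lambda>h. 0)) (at p)"
    by (rule has_derivative_transform_within_open[OF has_derivative_const[of 1] assms(1,2)])
      (simp add: assms(4) dot_square_norm)
  ultimately have "(\<lambda>h. f p \<bullet> ?D h + ?D h \<bullet> f p) = (\<lambda>h. 0)"
    by (rule has_derivative_unique)
  then have "f p \<bullet> ?D h + ?D h \<bullet> f p = 0"
    by (rule fun_cong)
  then show ?thesis
    by (simp add: inner_commute)
qed

lemma framed_surface_parallel:
  assumes "open U" "framed_surface U x n s"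
  shows "framed_surface U (\<lambda>p. x p + n p) n s"
proof -
  have frame: "(n p, s p) \<in> orthonormal_pairs" if "p \<in> U" for p
    using assms(2) that unfolding framed_surface_def by auto
  have normal: "partial_u x p \<bullet> n p = 0" "partial_v x p \<bullet> n p = 0" if "p \<in> U" for p
    using assms(2) that unfolding framed_surface_def by auto
  have "smooth_on (\<lambda>p. (x p, n p, s p)) U"
    using assms(2) unfolding framed_surface_def by blast
  note comp = smooth_on_bounded_linear_comp[OF assms(1) _ this]
  have "bounded_linear (\<lambda>w :: (real^3) \<times> (real^3) \<times> (real^3). (fst w + fst (snd w), snd w))"
    by (intro bounded_linear_intros)
  from comp[OF this] have smooth': "smooth_on (\<lambda>p. (x p + n p, n p, s p)) U"
    by simp
  have dx: "x differentiable (at p)" and dn: "n differentiable (at p)" if "p \<in> U" for p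
    using smooth_on_imp_differentiable[OF comp[OF bounded_linear_fst] that]
      smooth_on_imp_differentiable[OF comp[OF bounded_linear_fst_comp[OF bounded_linear_snd]] that]
    by simp_all
  have "frechet_derivative (\<lambda>q. x q + n q) (at p) h \<bullet> n p
      = frechet_derivative x (at p) h \<bullet> n p" if "p \<in> U" for p h
  proof -
    have "frechet_derivative (\<lambda>q. x q + n q) (at p) h
        = frechet_derivative x (at p) h + frechet_derivative n (at p) h"
      using frechet_derivative_at[OF has_derivative_add[OF
          dx[OF that, unfolded frechet_derivative_works]
          dn[OF that, unfolded frechet_derivative_works]], symmetric]
      by simp
    moreover have "frechet_derivative n (at p) h \<bullet> n p = 0"
      using frame
      by (intro unit_field_derivative_orthogonal[OF assms(1) that dn[OF that]])
        (auto simp: orthonormal_pairs_def)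
    ultimately show ?thesis
      by (simp add: inner_add_left)
  qed
  with smooth' frame normal show ?thesis
    unfolding framed_surface_def partial_u_def partial_v_def by simp
qed

theorem theorem3p3:
  fixes U :: "(real^2) set"
    and x n s :: "real^2 \<Rightarrow> real^3"
  assumes "open U" and "U \<noteq> {}" and "simply_connected U"
    and "framed_surface U x n s"
  shows "Bertrand_framed_surface U Frame_n Frame_n x n s"
proof -
  have parallel: "framed_surface U (\<lambda>p. x p + n p) n s"
    using framed_surface_parallel assms(1,4) by blast
  have "nonzero_densely_on (\<lambda>p. 1) U"
    unfolding nonzero_densely_on_def by (simp add: closure_subset)
  then have "mates U Frame_n Frame_n x n s (\<lambda>p. x p + n p) n s"
    unfolding mates_def using parallel assms(4) smooth_on_const
    by (intro conjI exI[of _ "\<lambda>p. 1"]) simp_all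
  with parallel show ?thesis
    unfolding Bertrand_framed_surface_def by blast
qed

end
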